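(* Let $f$ be a nondecreasing real-valued function on the nonnegative integers such that $\chi_{\mathrm{cen}}(G)\le f(\chi_{\mathrm{lin}}(G))$ for every graph $G$. Then $f(k)=\Omega(k^2/\log k)$; that is, there exist a constant $c>0$ and an integer $k_0\ge 2$ such that $f(k)\ge c\,k^2/\log k$ for every integer $k\ge k_0$.
   Context: All graphs are finite, simple, and undirected; connected graphs and paths are assumed to be nonnull (to have at least one vertex). All colorings are vertex-colorings (arbitrary assignments of colors to the vertices). $\log$ is the base-$2$ logarithm. For a coloring $\varphi$ of a graph $G$, a vertex $v$ of a subgraph $H$ of $G$ is a $\varphi$-center of $H$ if the color $\varphi(v)$ appears exactly once in $H$. The coloring $\varphi$ is centered if every connected subgraph of $G$ has a $\varphi$-center; it is linear if every path in $G$ (a path as a subgraph, not necessarily induced) has a $\varphi$-center. $\chi_{\mathrm{cen}}(G)$ (respectively $\chi_{\mathrm{lin}}(G)$) is the minimum number of colors in a centered (respectively linear) coloring of $G$. *)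

theory Defs
  imports Complex_Main "Graph_Theory.Graph_Theory"
begin

text \<open>
  A finite simple undirected graph is a \<open>pair_graph\<close>: a finite, loop-free, symmetric set of
  vertex pairs on a finite, possibly empty vertex set, each edge \<open>uv\<close> appearing as both
  \<open>(u, v)\<close> and \<open>(v, u)\<close>. The library's \<open>connected\<close> and \<open>vpath\<close> include nonemptiness.
\<close>

definition center :: "('a \<Rightarrow> 'c) \<Rightarrow> 'a pair_pre_digraph \<Rightarrow> 'a \<Rightarrow> bool" where
  "center \<phi> H v \<longleftrightarrow> v \<in> pverts H \<and> card {w \<in> pverts H. \<phi> w = \<phi> v} = 1"

definition centered_coloring :: "('a \<Rightarrow> 'c) \<Rightarrow> 'a pair_pre_digraph \<Rightarrow> bool" where
  "centered_coloring \<phi> G \<longleftrightarrow>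
    (\<forall>H :: 'a pair_pre_digraph. pair_graph H \<and> subgraph H G \<and> connected H \<longrightarrow> (\<exists>v. center \<phi> H v))"

definition path_graph :: "'a list \<Rightarrow> 'a pair_pre_digraph" where
  "path_graph p = \<lparr> pverts = set p, parcs = set (vwalk_arcs p) \<union> (set (vwalk_arcs p))\<inverse> \<rparr>"

definition linear_coloring :: "('a \<Rightarrow> 'c) \<Rightarrow> 'a pair_pre_digraph \<Rightarrow> bool" where
  "linear_coloring \<phi> G \<longleftrightarrow> (\<forall>p. vpath p G \<longrightarrow> (\<exists>v. center \<phi> (path_graph p) v))"

text \<open>
  Colors are natural numbers without loss of generality, since a finite graph uses only finitely
  many colors; the number of colors of a coloring is the number of colors that occur on vertices.
\<close>

definition chi_cen :: "'a pair_pre_digraph \<Rightarrow> nat" where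
  "chi_cen G = (LEAST k. \<exists>\<phi> :: 'a \<Rightarrow> nat. centered_coloring \<phi> G \<and> card (\<phi> ` pverts G) = k)"

definition chi_lin :: "'a pair_pre_digraph \<Rightarrow> nat" where
  "chi_lin G = (LEAST k. \<exists>\<phi> :: 'a \<Rightarrow> nat. linear_coloring \<phi> G \<and> card (\<phi> ` pverts G) = k)"

end

theory Submission
  imports Defs "HOL-Library.Nat_Bijection" "HOL-Library.Sublist"
begin

text \<open>
  Take the tree of depth \<open>d\<close> and arity \<open>w = 2 ^ L\<close>, replace every node by a clique on \<open>w\<close> vertices and
  join each clique vertex to its own child clique by a path of length about \<open>L\<close>, its port. Whenever
  a centered coloring has given a center to the current connected graph, the branch of the root
  clique that contains it can be thrown away, so each level costs \<open>w - 1\<close> new colors. For a linear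
  coloring, all cliques share \<open>w\<close> colors, and the \<open>b\<close>th port vertex is colored by the level, \<open>b\<close>
  and the \<open>b\<close>th bit of the index of the port. In its topmost clique a path meets at most two ports,
  because every branch it visits contains one of its ends. Two ports differ in some bit, which
  gives a center unless the path reaches this bit in neither of them; but then the path meets no
  other clique, and a clique color is unique. With \<open>w\<close> of order \<open>k\<close> and \<open>d\<close> of order
  \<open>k / log k\<close> this uses at most \<open>w + 2 d L \<le> k\<close> colors.
\<close>

section \<open>Walks through a cut vertex\<close>

text \<open>Membership in \<open>U\<close> changes along some arc, and symmetry of \<open>R\<close>
  lets that arc be read outward whichever of \<open>x\<close> and \<open>y\<close> comes
  first.\<close>

lemma walk_leaves:
  assumes "set (vwalk_arcs p) \<subseteq> R" "sym R" "x \<in> set p" "y \<in> set p" "x \<in> U" "y \<notin> U"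
  shows "\<exists>u v. u \<in> set p \<and> v \<in> set p \<and> (u, v) \<in> R \<and> u \<in> U \<and> v \<notin> U"
  using assms
proof (induction p arbitrary: x y rule: vwalk_arcs.induct)
  case (3 a b ps)
  have R: "(a, b) \<in> R" "(b, a) \<in> R"
    using "3.prems"(1,2) by (auto simp: sym_def)
  show ?case
  proof (cases "(a \<in> U) = (b \<in> U)")
    case False
    then show ?thesis using R by auto
  next
    case True
    obtain x' where "x' \<in> set (b # ps)" "x' \<in> U"
      using True "3.prems"(3,5) by (cases "x = a") auto
    moreover obtain y' where "y' \<in> set (b # ps)" "y' \<notin> U"
      using True "3.prems"(4,6) by (cases "y = a") auto
    moreover have "set (vwalk_arcs (b # ps)) \<subseteq> R"
      using "3.prems"(1) by simp
    ultimately have "\<exists>u v. u \<in> set (b # ps) \<and> v \<in> set (b # ps) \<and> (u, v) \<in> R \<and> u \<in> U \<and> v \<notin> U"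
      using "3.IH" "3.prems"(2) by blast
    then show ?thesis by auto
  qed
qed auto

lemma walk_meets_gate:
  assumes "set (vwalk_arcs p) \<subseteq> R" "sym R"
    and "\<And>u v. (u, v) \<in> R \<Longrightarrow> u \<in> U \<Longrightarrow> v \<notin> U \<Longrightarrow> v = c"
    and "x \<in> set p" "x \<in> U" "y \<in> set p" "y \<notin> U"
  shows "c \<in> set p"
  using walk_leaves[of p R x y U] assms by blast

lemma set_vwalk_arcs_append:
  "set (vwalk_arcs (xs @ [v])) \<subseteq> set (vwalk_arcs (xs @ v # ys))"
  "set (vwalk_arcs (v # ys)) \<subseteq> set (vwalk_arcs (xs @ v # ys))"
proof -
  show "set (vwalk_arcs (xs @ [v])) \<subseteq> set (vwalk_arcs (xs @ v # ys))"
  proof (induction xs)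
    case (Cons a xs) then show ?case by (cases xs) auto
  qed simp
  show "set (vwalk_arcs (v # ys)) \<subseteq> set (vwalk_arcs (xs @ v # ys))"
  proof (induction xs)
    case (Cons a xs) then show ?case by (cases xs) auto
  qed simp
qed

text \<open>If both ends lay outside \<open>U\<close>, the pieces before and after \<open>x\<close>
  would each contain the only exit \<open>c\<close>, which a path visits once.\<close>

lemma path_ends_behind_gate:
  assumes "set (vwalk_arcs p) \<subseteq> R" "sym R" "distinct p"
    and gate: "\<And>u v. (u, v) \<in> R \<Longrightarrow> u \<in> U \<Longrightarrow> v \<notin> U \<Longrightarrow> v = c"
    and "c \<notin> U" "x \<in> set p" "x \<in> U"
  shows "hd p \<in> U \<or> last p \<in> U"
proof (rule ccontr)
  assume ends: "\<not> (hd p \<in> U \<or> last p \<in> U)"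
  obtain xs ys where p: "p = xs @ x # ys"
    using \<open>x \<in> set p\<close> by (meson split_list)
  have "c \<in> set (xs @ [x])"
  proof (rule walk_meets_gate[where x = x and y = "hd p", OF _ \<open>sym R\<close> gate])
    show "set (vwalk_arcs (xs @ [x])) \<subseteq> R"
      using assms(1) set_vwalk_arcs_append(1)[of xs x ys] by (simp add: p)
    show "hd p \<in> set (xs @ [x])" by (cases xs) (auto simp: p)
  qed (use ends \<open>x \<in> U\<close> in auto)
  moreover have "c \<in> set (x # ys)"
  proof (rule walk_meets_gate[where x = x and y = "last p", OF _ \<open>sym R\<close> gate])
    show "set (vwalk_arcs (x # ys)) \<subseteq> R"
      using assms(1) set_vwalk_arcs_append(2)[of x ys xs] by (simp add: p)
    show "last p \<in> set (x # ys)" by (simp add: p)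
  qed (use ends \<open>x \<in> U\<close> in auto)
  ultimately show False
    using \<open>distinct p\<close> \<open>c \<notin> U\<close> \<open>x \<in> U\<close> by (auto simp: p)
qed

section \<open>A tree of cliques\<close>

text \<open>
  The pair of \<open>k\<close> and \<open>0\<close> is a clique vertex; the clique at the node \<open>butlast k\<close> of the tree
  contains one such vertex for each possible \<open>last k\<close>. The pairs of \<open>k\<close> and \<open>b = 1, \<dots>, L\<close> form
  the port, a path joining this vertex to the child clique at the node \<open>k\<close>. In the last level the
  ports are dangling.
\<close>

definition key :: "nat \<Rightarrow> nat list" where
  "key v = list_decode (fst (prod_decode v))"

definition pos :: "nat \<Rightarrow> nat" where
  "pos v = snd (prod_decode v)"

text \<open>Vertices are coded as numbers because the hypothesis of the theorem speaks about graphs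
  on \<open>nat\<close>.\<close>

definition vert :: "nat list \<Rightarrow> nat \<Rightarrow> nat" where
  "vert k b = prod_encode (list_encode k, b)"

lemma key_vert [simp]: "key (vert k b) = k"
  and pos_vert [simp]: "pos (vert k b) = b"
  by (simp_all add: key_def pos_def vert_def)

lemma vert_key_pos: "vert (key v) (pos v) = v"
  by (simp add: key_def pos_def vert_def)

lemma vert_eqI: "key u = key v \<Longrightarrow> pos u = pos v \<Longrightarrow> u = v"
  by (metis vert_key_pos)

definition tree_verts :: "nat \<Rightarrow> nat \<Rightarrow> nat set" where
  "tree_verts L d =
    {v. key v \<noteq> [] \<and> length (key v) \<le> d \<and> set (key v) \<subseteq> {..<2 ^ L} \<and> pos v \<le> L}"

text \<open>The edges along a port, inside a clique, and from the end of a port to every vertex of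
  the child clique.\<close>

definition tree_step :: "nat \<Rightarrow> nat \<Rightarrow> nat \<Rightarrow> bool" where
  "tree_step L u v \<longleftrightarrow>
    key u = key v \<and> pos v = Suc (pos u) \<or>
    pos u = 0 \<and> pos v = 0 \<and> key u \<noteq> key v \<and> butlast (key u) = butlast (key v) \<or>
    pos u = L \<and> pos v = 0 \<and> butlast (key v) = key u"

definition tree_on :: "nat \<Rightarrow> nat set \<Rightarrow> nat pair_pre_digraph" where
  "tree_on L S =
    \<lparr> pverts = S, parcs = {(u, v). u \<in> S \<and> v \<in> S \<and> (tree_step L u v \<or> tree_step L v u)} \<rparr>"

abbreviation clique_tree :: "nat \<Rightarrow> nat \<Rightarrow> nat pair_pre_digraph" where
  "clique_tree L d \<equiv> tree_on L (tree_verts L d)"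

lemma pverts_tree_on [simp]: "pverts (tree_on L S) = S"
  by (simp add: tree_on_def)

lemma parcs_tree_on: "(u, v) \<in> parcs (tree_on L S) \<longleftrightarrow>
    u \<in> S \<and> v \<in> S \<and> (tree_step L u v \<or> tree_step L v u)"
  by (simp add: tree_on_def)

lemma sym_parcs_tree_on: "sym (parcs (tree_on L S))"
  by (auto simp: sym_def parcs_tree_on)

lemma finite_tree_verts [simp]: "finite (tree_verts L d)"
proof (rule finite_subset)
  show "tree_verts L d \<subseteq> (\<lambda>(k, b). vert k b) `
      ({k. set k \<subseteq> {..<2 ^ L} \<and> length k \<le> d} \<times> {..L})"
  proof
    fix v assume "v \<in> tree_verts L d"
    then show "v \<in> (\<lambda>(k, b). vert k b) `
        ({k. set k \<subseteq> {..<2 ^ L} \<and> length k \<le> d} \<times> {..L})"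
      by (intro image_eqI[of _ _ "(key v, pos v)"]) (auto simp: tree_verts_def vert_key_pos)
  qed
  show "finite ((\<lambda>(k, b). vert k b) ` ({k. set k \<subseteq> {..<2 ^ L} \<and> length k \<le> d} \<times> {..L}))"
    by (intro finite_imageI finite_cartesian_product finite_lists_length_le) auto
qed

lemma tree_step_irrefl: "key v \<noteq> [] \<Longrightarrow> \<not> tree_step L v v"
proof
  assume "key v \<noteq> []" "tree_step L v v"
  then have "butlast (key v) = key v" by (auto simp: tree_step_def)
  then have "length (key v) - 1 = length (key v)" by (metis length_butlast)
  with \<open>key v \<noteq> []\<close> show False by (cases "key v") auto
qed

lemma pair_graph_tree_on:
  assumes "S \<subseteq> tree_verts L d"
  shows "pair_graph (tree_on L S)"
proof -
  have fin: "finite S" using assms finite_subset finite_tree_verts by blast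
  have "parcs (tree_on L S) \<subseteq> S \<times> S" by (auto simp: parcs_tree_on)
  then have "finite (parcs (tree_on L S))"
    using fin finite_subset by blast
  moreover have "fst e \<noteq> snd e" if "e \<in> parcs (tree_on L S)" for e
  proof (cases e)
    case (Pair u v)
    then show ?thesis
      using that assms tree_step_irrefl[of u L] by (auto simp: parcs_tree_on tree_verts_def)
  qed
  ultimately show ?thesis
    using fin sym_parcs_tree_on
    by unfold_locales (auto simp: parcs_tree_on symmetric_def)
qed

lemma subgraph_tree_on:
  assumes "S \<subseteq> tree_verts L d"
  shows "subgraph (tree_on L S) (clique_tree L d)"
proof -
  interpret G: pair_graph "clique_tree L d" by (rule pair_graph_tree_on[OF subset_refl])
  interpret H: pair_graph "tree_on L S" by (rule pair_graph_tree_on) fact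
  show ?thesis
    using assms G.wf_digraph_axioms H.wf_digraph_axioms
    by (auto simp: subgraph_def parcs_tree_on)
qed

section \<open>A linear coloring with few colors\<close>

text \<open>The side away from the root that the cut vertex \<open>vert k b\<close> separates from
  the rest.\<close>

definition behind :: "nat list \<Rightarrow> nat \<Rightarrow> nat set" where
  "behind k b = {v. key v = k \<and> b < pos v \<or> strict_prefix k (key v)}"

lemma behind_gate:
  assumes "u \<in> tree_verts L d" "v \<in> tree_verts L d" "tree_step L u v \<or> tree_step L v u"
    and "u \<in> behind k b" "v \<notin> behind k b" "b \<le> L"
  shows "v = vert k b"
proof -
  have ne: "key u \<noteq> []" "key v \<noteq> []" and L: "pos u \<le> L" "pos v \<le> L"
    using assms by (auto simp: tree_verts_def)
  \<comment> \<open>Properly extending \<open>k\<close> becomes a condition on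
    \<open>butlast\<close>, the form in which \<open>tree_step\<close> compares keys.\<close>
  have strict: "strict_prefix k x \<longleftrightarrow> prefix k (butlast x)" if "x \<noteq> []" for x
    using that by (cases x rule: rev_cases) (auto simp: strict_prefix_def dest: prefix_length_le)
  have prefix: "prefix k x \<longleftrightarrow> x = k \<or> prefix k (butlast x)" if "x \<noteq> []" for x
    using strict[OF that] by (auto simp: strict_prefix_def)
  have "key v = k \<and> pos v = b"
    using assms(3-6) L unfolding tree_step_def behind_def
    by (auto simp: strict[OF ne(1)] strict[OF ne(2)] prefix[OF ne(1)] prefix[OF ne(2)])
  then show ?thesis by (metis vert_key_pos)
qed

text \<open>Clique colors ignore the level, so all cliques share them. Bits count from 0 but port
  positions from 1, hence \<open>pos v - 1\<close>.\<close>

definition port_coloring :: "nat \<Rightarrow> nat" where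
  "port_coloring v = to_nat (if pos v = 0 then Inl (last (key v))
    else Inr (length (key v), pos v, bit (last (key v)) (pos v - 1)) :: nat + nat \<times> nat \<times> bool)"

lemma card_port_coloring:
  "card (port_coloring ` tree_verts L d) \<le> 2 ^ L + 2 * d * L"
proof -
  let ?C = "Inl ` {..<2 ^ L} \<union> Inr ` ({1..d} \<times> {1..L} \<times> UNIV) :: (nat + nat \<times> nat \<times> bool) set"
  have "port_coloring ` tree_verts L d \<subseteq> to_nat ` ?C"
  proof
    fix c assume "c \<in> port_coloring ` tree_verts L d"
    then obtain v where v: "v \<in> tree_verts L d" "c = port_coloring v" by blast
    then have "last (key v) \<in> set (key v)" by (simp add: tree_verts_def)
    then have "last (key v) < 2 ^ L" using v(1) unfolding tree_verts_def by blast
    moreover have "length (key v) \<in> {1..d}" using v by (auto simp: tree_verts_def Suc_le_eq)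
    ultimately show "c \<in> to_nat ` ?C"
      using v unfolding port_coloring_def v(2)
      by (intro imageI) (auto simp: tree_verts_def)
  qed
  then have "card (port_coloring ` tree_verts L d) \<le> card (to_nat ` ?C)"
    by (intro card_mono) auto
  also have "\<dots> \<le> card ?C" by (rule card_image_le) auto
  also have "\<dots> \<le> card (Inl ` {..<2 ^ L} :: (nat + nat \<times> nat \<times> bool) set)
      + card (Inr ` ({1..d} \<times> {1..L} \<times> UNIV) :: (nat + nat \<times> nat \<times> bool) set)"
    by (rule card_Un_le)
  also have "\<dots> = 2 ^ L + 2 * d * L"
    by (simp add: card_image card_cartesian_product)
  finally show ?thesis .
qed

lemma port_coloring_eq_clique:
  "pos u = 0 \<Longrightarrow> port_coloring v = port_coloring u \<longleftrightarrow> pos v = 0 \<and> last (key v) = last (key u)"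
  by (auto simp: port_coloring_def)

lemma port_coloring_eq_port:
  "pos u \<noteq> 0 \<Longrightarrow> port_coloring v = port_coloring u \<longleftrightarrow> length (key v) = length (key u) \<and>
    pos v = pos u \<and> bit (last (key v)) (pos u - 1) = bit (last (key u)) (pos u - 1)"
  by (auto simp: port_coloring_def)

lemma exists_differing_bit:
  assumes "x < 2 ^ L" "y < 2 ^ L" "(x::nat) \<noteq> y"
  shows "\<exists>b<L. bit x b \<noteq> bit y b"
proof (rule ccontr)
  assume "\<not> (\<exists>b<L. bit x b \<noteq> bit y b)"
  then have "take_bit L x = take_bit L y"
    by (auto simp: bit_eq_iff bit_take_bit_iff)
  then show False using assms by (simp add: take_bit_nat_eq_self)
qed

lemma center_path_graphI:
  assumes "u \<in> set p" "\<And>v. v \<in> set p \<Longrightarrow> \<phi> v = \<phi> u \<Longrightarrow> v = u"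
  shows "center \<phi> (path_graph p) u"
proof -
  have "{w \<in> set p. \<phi> w = \<phi> u} = {u}" using assms by auto
  then show ?thesis using assms(1) by (simp add: center_def path_graph_def)
qed

lemma linear_port_coloring:
  assumes "L \<ge> 1"
  shows "linear_coloring port_coloring (clique_tree L d)"
  unfolding linear_coloring_def
proof (intro allI impI)
  fix p assume "vpath p (clique_tree L d)"
  then have pV: "set p \<subseteq> tree_verts L d"
    and pR: "set (vwalk_arcs p) \<subseteq> parcs (clique_tree L d)"
    and "p \<noteq> []" "distinct p"
    by (auto simp: vpath_def vwalk_def)
  define R where "R = parcs (clique_tree L d)"
  have gate: "v = vert k b" if "(u, v) \<in> R" "u \<in> behind k b" "v \<notin> behind k b" "b \<le> L" for u v k b
    using that behind_gate unfolding R_def parcs_tree_on by blast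
  have meets: "vert k b \<in> set p"
    if "x \<in> set p" "x \<in> behind k b" "y \<in> set p" "y \<notin> behind k b" "b \<le> L" for x y k b
    by (rule walk_meets_gate[OF pR[folded R_def] _ gate])
      (use that sym_parcs_tree_on in \<open>auto simp: R_def\<close>)
  have ends: "hd p \<in> behind k 0 \<or> last p \<in> behind k 0" if "x \<in> set p" "x \<in> behind k 0" for x k
    by (rule path_ends_behind_gate[OF pR[folded R_def] _ \<open>distinct p\<close> gate _ that])
      (auto simp: R_def sym_parcs_tree_on behind_def)
  \<comment> \<open>A vertex of least level; \<open>a\<close> is then the node of the topmost clique
    whose vertices or ports the path meets.\<close>
  define r where "r = (ARG_MIN (\<lambda>v. length (key v)) v. v \<in> set p)"
  have r: "r \<in> set p" and min: "\<And>v. v \<in> set p \<Longrightarrow> length (key r) \<le> length (key v)"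
    using arg_min_nat_lemma[of "\<lambda>v. v \<in> set p" "hd p" "\<lambda>v. length (key v)"] \<open>p \<noteq> []\<close>
    unfolding r_def by auto
  define a where "a = butlast (key r)"
  have len: "length (key r) = Suc (length a)"
    using r pV by (auto simp: a_def tree_verts_def)
  \<comment> \<open>Along an arc a key changes at most in its last entry or gains or loses one
    entry. All keys on the path are longer than \<open>a\<close>, so their beginning never
    changes.\<close>
  have prefix_a: "take (length a) (key v) = a" if v: "v \<in> set p" for v
  proof (rule ccontr)
    define U where "U = {v. take (length a) (key v) = a}"
    assume "take (length a) (key v) \<noteq> a"
    then have "v \<notin> U" by (simp add: U_def)
    moreover have "r \<in> U" by (simp add: U_def a_def butlast_conv_take)
    ultimately obtain x y where xy: "x \<in> set p" "y \<in> set p" "(x, y) \<in> R" "x \<in> U" "y \<notin> U"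
      using walk_leaves[OF pR sym_parcs_tree_on r v] unfolding R_def by blast
    have "take (length a) (key x) = take (length a) (butlast (key x))"
      "take (length a) (key y) = take (length a) (butlast (key y))"
      using min[OF xy(1)] min[OF xy(2)] len by (auto simp: take_butlast)
    then show False
      using xy(3-5) unfolding R_def parcs_tree_on tree_step_def U_def mem_Collect_eq by metis
  qed
  have top: "key v = a @ [last (key v)]" if "v \<in> set p" "length (key v) = Suc (length a)" for v
    using prefix_a[OF that(1)] that(2)
    by (metis append_butlast_last_id butlast_conv_take diff_Suc_1 length_0_conv nat.distinct(1))
  have deep: "\<exists>i. strict_prefix (a @ [i]) (key v)"
    if "v \<in> set p" "length (key v) \<noteq> Suc (length a)" for v
  proof
    have "Suc (length a) < length (key v)" using min[OF that(1)] that(2) len by simp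
    then show "strict_prefix (a @ [key v ! length a]) (key v)"
      using prefix_a[OF that(1)]
      by (metis Suc_lessD take_Suc_conv_app_nth take_is_prefix prefix_order.le_less
          length_append_singleton less_irrefl)
  qed
  have last_less: "last (key v) < 2 ^ L" if "v \<in> set p" for v
    using that pV last_in_set[of "key v"] unfolding tree_verts_def by blast
  show "\<exists>v. center port_coloring (path_graph p) v"
  proof (cases "\<exists>u \<in> set p. length (key u) = Suc (length a) \<and> pos u \<noteq> 0")
    case False
    \<comment> \<open>Going deeper would lead through the last port vertex, whose position
      \<open>L\<close> is nonzero by \<open>L \<ge> 1\<close>.\<close>
    have shallow: "length (key v) = Suc (length a)" if v: "v \<in> set p" for v
    proof (rule ccontr)
      assume "length (key v) \<noteq> Suc (length a)"
      then obtain i where "strict_prefix (a @ [i]) (key v)" using deep v by blast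
      moreover have "r \<notin> behind (a @ [i]) L"
        using r False pV len by (auto simp: behind_def dest: prefix_length_less)
      ultimately have "vert (a @ [i]) L \<in> set p"
        using meets[OF v _ r, of "a @ [i]" L] by (auto simp: behind_def)
      then show False using False assms by force
    qed
    have "center port_coloring (path_graph p) r"
    proof (rule center_path_graphI[OF r])
      fix v assume v: "v \<in> set p" "port_coloring v = port_coloring r"
      have "pos r = 0" using False r shallow by blast
      then have "pos v = 0" "last (key v) = last (key r)"
        using v port_coloring_eq_clique by auto
      then show "v = r"
        using top v(1) r shallow \<open>pos r = 0\<close> by (metis vert_eqI)
    qed
    then show ?thesis ..
  next
    case True
    then obtain u where u: "u \<in> set p" "length (key u) = Suc (length a)" "pos u \<noteq> 0" by blast
    show ?thesis
    proof (rule ccontr)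
      assume "\<not> ?thesis"
      then have no_center: "\<exists>v \<in> set p. v \<noteq> x \<and> port_coloring v = port_coloring x"
        if "x \<in> set p" for x
        using center_path_graphI[OF that] by blast
      \<comment> \<open>A port color fixes level and position, and below \<open>a\<close> the level
        fixes the clique. So a second vertex of this color lies in another port of the same clique,
        with an equal bit.\<close>
      have twin: "\<exists>i'. i' \<noteq> i \<and> vert (a @ [i']) b \<in> set p \<and> bit i' (b - 1) = bit i (b - 1)"
        if x: "vert (a @ [i]) b \<in> set p" "b \<noteq> 0" for i b
      proof -
        obtain v where v: "v \<in> set p" "v \<noteq> vert (a @ [i]) b"
            "port_coloring v = port_coloring (vert (a @ [i]) b)"
          using no_center[OF x(1)] by blast
        then have *: "length (key v) = Suc (length a)" "pos v = b"
            "bit (last (key v)) (b - 1) = bit i (b - 1)"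
          using x(2) by (auto simp: port_coloring_eq_port)
        then have "v = vert (a @ [last (key v)]) b"
          using top[OF v(1)] by (metis vert_key_pos)
        with v * show ?thesis by (metis)
      qed
      define i1 b1 where "i1 = last (key u)" and "b1 = pos u"
      have u': "vert (a @ [i1]) b1 \<in> set p" "b1 \<noteq> 0" "b1 \<le> L"
        using u top[OF u(1,2)] pV by (auto simp: i1_def b1_def tree_verts_def) (metis vert_key_pos)
      obtain i2 where i2: "i2 \<noteq> i1" "vert (a @ [i2]) b1 \<in> set p"
        using twin[OF u'(1,2)] by blast
      have behind_disjoint: "behind (a @ [i]) 0 \<inter> behind (a @ [j]) 0 = {}" if "i \<noteq> j" for i j
      proof -
        have False if "prefix (a @ [i]) k" "prefix (a @ [j]) k" for k
          using that \<open>i \<noteq> j\<close> by (auto simp: prefix_def)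
        then show ?thesis by (auto simp: behind_def) (metis prefix_order.le_less)+
      qed
      \<comment> \<open>A branch visited by the path contains one of its two ends.\<close>
      have two: "i = i1 \<or> i = i2" if x: "vert (a @ [i]) b \<in> set p" "b \<noteq> 0" for i b
      proof (rule ccontr)
        assume "\<not> ?thesis"
        then have "behind (a @ [i]) 0 \<inter> behind (a @ [i1]) 0 = {}"
          "behind (a @ [i]) 0 \<inter> behind (a @ [i2]) 0 = {}"
          "behind (a @ [i1]) 0 \<inter> behind (a @ [i2]) 0 = {}"
          using behind_disjoint i2(1) by auto
        moreover have "hd p \<in> behind (a @ [i]) 0 \<or> last p \<in> behind (a @ [i]) 0"
          "hd p \<in> behind (a @ [i1]) 0 \<or> last p \<in> behind (a @ [i1]) 0"
          "hd p \<in> behind (a @ [i2]) 0 \<or> last p \<in> behind (a @ [i2]) 0"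
          using ends[OF x(1)] ends[OF u'(1)] ends[OF i2(2)] x(2) u'(2)
          by (auto simp: behind_def)
        ultimately show False by blast
      qed
      have less: "i1 < 2 ^ L" "i2 < 2 ^ L"
        using last_less[OF u'(1)] last_less[OF i2(2)] by simp_all
      obtain c where c: "c < L" "bit i1 c \<noteq> bit i2 c"
        using exists_differing_bit[OF less] i2(1) by blast
      \<comment> \<open>Position \<open>Suc c\<close> is colored by bit \<open>c\<close>, in which
        \<open>i1\<close> and \<open>i2\<close> differ, so a twin there would need a third
        port.\<close>
      have missing: "vert (a @ [i]) (Suc c) \<notin> set p" if "i = i1 \<or> i = i2" for i
      proof
        assume "vert (a @ [i]) (Suc c) \<in> set p"
        then obtain i' where "i' \<noteq> i" "vert (a @ [i']) (Suc c) \<in> set p" "bit i' c = bit i c"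
          using twin[of i "Suc c"] by auto
        then show False using two[of i' "Suc c"] that c(2) by auto
      qed
      \<comment> \<open>The path visits the ports \<open>i1\<close> and \<open>i2\<close>, and at
        least one of them lies outside any given branch at \<open>a\<close>.\<close>
      have other: "\<exists>y \<in> set p. y \<notin> behind (a @ [i]) b" for i b
      proof (cases "i = i1")
        case True
        then show ?thesis using i2 by (intro bexI[OF _ i2(2)]) (auto simp: behind_def dest: prefix_length_less)
      next
        case False
        then show ?thesis by (intro bexI[OF _ u'(1)]) (auto simp: behind_def dest: prefix_length_less)
      qed
      \<comment> \<open>A descent crosses a whole port: position 1 forces its index to be
        \<open>i1\<close> or \<open>i2\<close>, but then position \<open>Suc c\<close> is
        missing.\<close>
      have shallow: "length (key v) = Suc (length a)" if v: "v \<in> set p" for v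
      proof (rule ccontr)
        assume "length (key v) \<noteq> Suc (length a)"
        then obtain i where i: "strict_prefix (a @ [i]) (key v)" using deep v by blast
        have through: "vert (a @ [i]) b \<in> set p" if "b \<le> L" for b
          using meets[OF v, of "a @ [i]" b] other[of i b] i that by (auto simp: behind_def)
        show False
          using two[OF through[of 1]] missing through[of "Suc c"] assms c(1) by auto
      qed
      \<comment> \<open>Leaving the port \<open>i1\<close> takes the path through its clique vertex.
        As the path meets no other clique, the color of that vertex cannot recur.\<close>
      have v0: "vert (a @ [i1]) 0 \<in> set p"
        using meets[OF u'(1), of "a @ [i1]" 0] other[of i1 0] u'(2) by (auto simp: behind_def)
      obtain v where v: "v \<in> set p" "v \<noteq> vert (a @ [i1]) 0"
          "port_coloring v = port_coloring (vert (a @ [i1]) 0)"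
        using no_center[OF v0] by blast
      then have "pos v = 0" "last (key v) = i1"
        by (auto simp: port_coloring_eq_clique)
      then show False
        using v(1,2) top[OF v(1) shallow[OF v(1)]] by (metis vert_key_pos)
    qed
  qed
qed

lemma chi_lin_clique_tree:
  assumes "L \<ge> 1"
  shows "chi_lin (clique_tree L d) \<le> 2 ^ L + 2 * d * L"
proof -
  have "chi_lin (clique_tree L d) \<le> card (port_coloring ` tree_verts L d)"
    unfolding chi_lin_def using linear_port_coloring[OF assms, of d]
    by (intro Least_le exI[of _ port_coloring]) simp
  then show ?thesis using card_port_coloring[of L d] by linarith
qed

section \<open>Centered colorings need many colors\<close>

text \<open>\<open>T\<close> is a set because the branches at the node \<open>a\<close> get removed
  one at a time.\<close>

definition branches :: "nat \<Rightarrow> nat \<Rightarrow> nat list \<Rightarrow> nat set \<Rightarrow> nat set" where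
  "branches L d a T = {v \<in> tree_verts L d. \<exists>i\<in>T. prefix (a @ [i]) (key v)}"

text \<open>Climb toward the root, from a port to its clique vertex and from there to the end of the
  port above, until the clique at \<open>a\<close> is reached.\<close>

lemma branches_reach_root:
  assumes "v \<in> branches L d a T"
  shows "\<exists>i\<in>T. vert (a @ [i]) 0 \<in> branches L d a T \<and>
    v \<rightarrow>\<^sup>*\<^bsub>with_proj (tree_on L (branches L d a T))\<^esub> vert (a @ [i]) 0"
  using assms
\<comment> \<open>Positions are at most \<open>L\<close>, so with weight \<open>Suc L\<close> one
  level up outweighs the jump from position 0 to \<open>L\<close>.\<close>
proof (induction "length (key v) * Suc L + pos v" arbitrary: v rule: less_induct)
  case less
  let ?S = "branches L d a T"
  interpret H: pair_graph "tree_on L ?S"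
    by (rule pair_graph_tree_on[of _ L d]) (auto simp: branches_def)
  obtain i where i: "i \<in> T" "prefix (a @ [i]) (key v)" and v: "v \<in> tree_verts L d"
    using less.prems by (auto simp: branches_def)
  have step: ?case if w: "w \<in> ?S" "tree_step L w v"
    "length (key w) * Suc L + pos w < length (key v) * Suc L + pos v" for w
  proof -
    obtain j where j: "j \<in> T" "vert (a @ [j]) 0 \<in> ?S"
        "w \<rightarrow>\<^sup>*\<^bsub>with_proj (tree_on L ?S)\<^esub> vert (a @ [j]) 0"
      using less.hyps[OF w(3,1)] by (elim bexE conjE)
    have "(v, w) \<in> parcs (tree_on L ?S)"
      using w(1,2) less.prems by (simp only: parcs_tree_on simp_thms)
    from j(1,2) H.adj_reachable_trans[OF this j(3)] show ?thesis
      by (intro bexI[of _ j] conjI)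
  qed
  consider "pos v \<noteq> 0" | "pos v = 0" "key v = a @ [i]" | "pos v = 0" "key v \<noteq> a @ [i]" by blast
  then show ?case
  proof cases
    case 1
    show ?thesis
    proof (rule step)
      show "vert (key v) (pos v - 1) \<in> ?S"
        using less.prems by (auto simp: branches_def tree_verts_def)
    qed (use 1 in \<open>auto simp: tree_step_def\<close>)
  next
    case 2
    then have "v = vert (a @ [i]) 0" by (metis vert_key_pos)
    then show ?thesis using i less.prems by auto
  next
    case 3
    have key_v: "butlast (key v) @ [last (key v)] = key v"
      using v by (simp add: tree_verts_def)
    have pre: "prefix (a @ [i]) (butlast (key v))"
      using i(2) 3(2) prefix_snoc[of "a @ [i]" "butlast (key v)" "last (key v)"]
      unfolding key_v by auto
    then have "butlast (key v) \<noteq> []" by auto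
    moreover have "set (butlast (key v)) \<subseteq> set (key v)" by (auto dest: in_set_butlastD)
    ultimately have mem: "vert (butlast (key v)) L \<in> ?S"
      using v i(1) pre by (auto simp: branches_def tree_verts_def)
    have "length (key v) = Suc (length (butlast (key v)))"
      using key_v by (metis length_append_singleton)
    then show ?thesis
      using 3(1) by (intro step[OF mem]) (auto simp: tree_step_def simp del: length_butlast)
  qed
qed

text \<open>Every vertex reaches some \<open>vert (a @ [i]) 0\<close> with \<open>i\<close> in
  \<open>T\<close>, and these are pairwise adjacent; \<open>length a < d\<close> puts them in the
  tree.\<close>

lemma connected_branches:
  assumes "T \<noteq> {}" "length a < d" "set a \<subseteq> {..<2 ^ L}" "T \<subseteq> {..<2 ^ L}"
  shows "connected (tree_on L (branches L d a T))"
proof -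
  let ?S = "branches L d a T"
  let ?H = "with_proj (tree_on L ?S)"
  interpret H: pair_graph "tree_on L ?S"
    by (rule pair_graph_tree_on[of _ L d]) (auto simp: branches_def)
  have root: "vert (a @ [i]) 0 \<in> ?S" if "i \<in> T" for i
    using that assms by (auto simp: branches_def tree_verts_def)
  have "u \<rightarrow>\<^sup>*\<^bsub>?H\<^esub> v" if uv: "u \<in> ?S" "v \<in> ?S" for u v
  proof -
    obtain i where i: "i \<in> T" "u \<rightarrow>\<^sup>*\<^bsub>?H\<^esub> vert (a @ [i]) 0"
      using branches_reach_root[OF uv(1)] by blast
    obtain j where j: "j \<in> T" "v \<rightarrow>\<^sup>*\<^bsub>?H\<^esub> vert (a @ [j]) 0"
      using branches_reach_root[OF uv(2)] by blast
    have ij: "vert (a @ [i]) 0 \<rightarrow>\<^sup>*\<^bsub>?H\<^esub> vert (a @ [j]) 0"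
    proof (cases "i = j")
      case True
      then show ?thesis using root[OF i(1)] by simp
    next
      case False
      then show ?thesis
        using root[OF i(1)] root[OF j(1)]
        by (intro H.reachable_adjI) (simp add: parcs_tree_on tree_step_def)
    qed
    have "vert (a @ [j]) 0 \<rightarrow>\<^sup>*\<^bsub>?H\<^esub> v"
      by (rule symmetric_reachable[OF H.sym_arcs j(2)])
    with i(2) ij show ?thesis by (meson H.reachable_trans)
  qed
  moreover have "?S \<noteq> {}" using assms(1) root by blast
  ultimately have "strongly_connected ?H"
    by (intro strongly_connectedI) auto
  then show ?thesis
    unfolding connected_def strongly_connected_def
    using H.reachable_mk_symmetricI by auto
qed

text \<open>
  Deleting the branch that contains a center of the union of some branches leaves a connected graph
  in which the color of that center does not occur.
\<close>

lemma centered_coloring_drop_branch: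
  assumes "centered_coloring \<phi> (clique_tree L d)"
    and "length a < d" "set a \<subseteq> {..<2 ^ L}" "T \<noteq> {}" "T \<subseteq> {..<2 ^ L}"
  shows "\<exists>i\<in>T. card (\<phi> ` branches L d a (T - {i})) < card (\<phi> ` branches L d a T)"
proof -
  let ?S = "branches L d a"
  have sub: "?S T \<subseteq> tree_verts L d" by (auto simp: branches_def)
  obtain v where "center \<phi> (tree_on L (?S T)) v"
    using assms(1) pair_graph_tree_on[OF sub] subgraph_tree_on[OF sub]
      connected_branches[OF assms(4,2,3,5)]
    unfolding centered_coloring_def by blast
  then have v: "v \<in> ?S T" and "card {w \<in> ?S T. \<phi> w = \<phi> v} = 1"
    by (simp_all add: center_def)
  then obtain x where x: "{w \<in> ?S T. \<phi> w = \<phi> v} = {x}" by (auto simp: card_1_singleton_iff)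
  have unique: "w = v" if "w \<in> ?S T" "\<phi> w = \<phi> v" for w
  proof -
    have "w \<in> {x}" "v \<in> {x}" unfolding x[symmetric] using v that by auto
    then show ?thesis by simp
  qed
  obtain i where i: "i \<in> T" "prefix (a @ [i]) (key v)"
    using v by (auto simp: branches_def)
  then have "v \<notin> ?S (T - {i})"
    by (auto simp: branches_def prefix_def)
  moreover have subset: "?S (T - {i}) \<subseteq> ?S T" by (auto simp: branches_def)
  ultimately have "\<phi> v \<notin> \<phi> ` ?S (T - {i})" using unique by fastforce
  then have "\<phi> ` ?S (T - {i}) \<subset> \<phi> ` ?S T" using subset v by blast
  moreover have "finite (\<phi> ` ?S T)"
    using finite_subset[OF sub finite_tree_verts] by (rule finite_imageI)
  ultimately have "card (\<phi> ` ?S (T - {i})) < card (\<phi> ` ?S T)"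
    by (intro psubset_card_mono)
  then show ?thesis using i(1) by (rule bexI)
qed

text \<open>Dropping branches until one is left costs a color each. The survivor contains all
  branches at the next node, to which induction on the number \<open>n\<close> of further levels
  applies.\<close>

lemma card_centered_branches:
  assumes "centered_coloring \<phi> (clique_tree L d)"
    and "length a + Suc n = d" "set a \<subseteq> {..<2 ^ L}" "T \<noteq> {}" "T \<subseteq> {..<2 ^ L}"
  shows "card T - 1 + n * (2 ^ L - 1) \<le> card (\<phi> ` branches L d a T)"
proof -
  \<comment> \<open>The centers dictate which branch survives, so \<open>m\<close> must bound every
    single branch.\<close>
  have step: "card T - 1 + m \<le> card (\<phi> ` branches L d a T)"
    if a: "length a < d" "set a \<subseteq> {..<2 ^ L}"
      and single: "\<And>i. i < 2 ^ L \<Longrightarrow> m \<le> card (\<phi> ` branches L d a {i})"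
      and T: "T \<noteq> {}" "T \<subseteq> {..<2 ^ L}" for a T m
    using T
  proof (induction "card T" arbitrary: T rule: less_induct)
    case less
    have fin: "finite T" using less.prems(2) finite_subset by blast
    show ?case
    proof (cases "card T = 1")
      case True
      then obtain i where "T = {i}" by (auto simp: card_1_singleton_iff)
      then show ?thesis using single[of i] less.prems(2) by simp
    next
      case False
      obtain i where i: "i \<in> T"
          "card (\<phi> ` branches L d a (T - {i})) < card (\<phi> ` branches L d a T)"
        using centered_coloring_drop_branch[OF assms(1) a less.prems] by blast
      have "card T \<noteq> 0" using fin less.prems(1) by simp
      moreover have card: "card (T - {i}) = card T - 1" using i(1) by simp
      ultimately have "card (T - {i}) < card T" "card (T - {i}) \<noteq> 0"
        using False by linarith+
      then have "card (T - {i}) < card T" "T - {i} \<noteq> {}" by (metis card.empty)+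
      then have "card (T - {i}) - 1 + m \<le> card (\<phi> ` branches L d a (T - {i}))"
        using less.hyps[of "T - {i}"] less.prems(2) by blast
      then show ?thesis using i(2) card by linarith
    qed
  qed
  show ?thesis
    using assms(2-)
  proof (induction n arbitrary: a T)
    case 0
    then show ?case using step[where a = a and m = 0 and T = T] by simp
  next
    case (Suc n)
    have "Suc n * (2 ^ L - 1) \<le> card (\<phi> ` branches L d a {i})" if i: "i < 2 ^ L" for i
    proof -
      have "Suc n * (2 ^ L - 1) = card {..<2 ^ L :: nat} - 1 + n * (2 ^ L - 1)" by simp
      also have "\<dots> \<le> card (\<phi> ` branches L d (a @ [i]) {..<2 ^ L})"
        using Suc.prems i by (intro Suc.IH) auto
      also have "\<dots> \<le> card (\<phi> ` branches L d a {i})"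
      proof (intro card_mono image_mono finite_imageI)
        show "finite (branches L d a {i})"
          by (rule finite_subset[OF _ finite_tree_verts[of L d]]) (auto simp: branches_def)
        show "branches L d (a @ [i]) {..<2 ^ L} \<subseteq> branches L d a {i}"
          by (auto simp: branches_def prefix_def)
      qed
      finally show ?thesis .
    qed
    then show ?case using step[where a = a and m = "Suc n * (2 ^ L - 1)" and T = T] Suc.prems by simp
  qed
qed

lemma chi_cen_clique_tree:
  "d * (2 ^ L - 1) \<le> chi_cen (clique_tree L d)"
proof (cases d)
  case (Suc n)
  \<comment> \<open>A coloring with distinct colors is centered, so the minimum in
    \<open>chi_cen\<close> is attained.\<close>
  have "centered_coloring (\<lambda>v :: nat. v) (clique_tree L d)"
    unfolding centered_coloring_def
  proof (intro allI impI)
    fix H :: "nat pair_pre_digraph"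
    assume "pair_graph H \<and> subgraph H (clique_tree L d) \<and> connected H"
    then obtain v where "v \<in> pverts H"
      by (auto simp: connected_def strongly_connected_def)
    moreover from this have "{w \<in> pverts H. w = v} = {v}" by auto
    ultimately show "\<exists>v. center (\<lambda>v. v) H v"
      unfolding center_def by (metis is_singletonI is_singleton_altdef)
  qed
  then have "\<exists>k (\<phi> :: nat \<Rightarrow> nat). centered_coloring \<phi> (clique_tree L d) \<and>
      card (\<phi> ` pverts (clique_tree L d)) = k"
    by (intro exI[of _ "card ((\<lambda>v. v) ` tree_verts L d)"] exI[of _ "\<lambda>v. v"]) simp
  from LeastI_ex[OF this] obtain \<phi> :: "nat \<Rightarrow> nat" where \<phi>: "centered_coloring \<phi> (clique_tree L d)"
      "card (\<phi> ` tree_verts L d) = chi_cen (clique_tree L d)"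
    unfolding chi_cen_def by auto
  have "card {..<2 ^ L :: nat} - 1 + n * (2 ^ L - 1) \<le> card (\<phi> ` branches L d [] {..<2 ^ L})"
    using Suc by (intro card_centered_branches[OF \<phi>(1)]) (auto simp: lessThan_empty_iff)
  also have "\<dots> \<le> card (\<phi> ` tree_verts L d)"
    by (intro card_mono image_mono finite_imageI) (auto simp: branches_def)
  finally show ?thesis using \<phi>(2) Suc by simp
qed simp

section \<open>Choice of the parameters and the growth rate\<close>

(* Every finite graph is isomorphic to one whose vertices are natural numbers, so the
   hypothesis ranges over all graphs up to isomorphism. *)
theorem mainTheorem2:
  fixes f :: "nat \<Rightarrow> real"
  assumes "mono f"
    and "\<And>G :: nat pair_pre_digraph. pair_graph G \<Longrightarrow> real (chi_cen G) \<le> f (chi_lin G)"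
  shows "\<exists>c > 0. \<exists>k0 \<ge> 2. \<forall>k \<ge> k0. f k \<ge> c * (real k)\<^sup>2 / log 2 (real k)"
proof -
  \<comment> \<open>The constant is the product of the factors 1/8 in
    \<open>d \<ge> k / (8 * L)\<close> and \<open>2 ^ L - 1 \<ge> k / 8\<close>;
    \<open>k \<ge> 16\<close> ensures \<open>L \<ge> 3\<close>.\<close>
  have "f k \<ge> 1 / 64 * (real k)\<^sup>2 / log 2 (real k)" if k: "k \<ge> 16" for k
  proof -
    have "\<exists>m. 2 ^ m \<le> k \<and> k < 2 ^ (m + 1)"
      by (rule ex_power_ivl1) (use k in auto)
    then obtain m where m: "2 ^ m \<le> k" "k < 2 ^ Suc m"
      unfolding Suc_eq_plus1 by blast
    have "m \<ge> 4"
    proof (rule ccontr)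
      assume "\<not> m \<ge> 4"
      then have "2 ^ Suc m \<le> (2::nat) ^ 4" by (intro power_increasing) auto
      then show False using m(2) k by simp
    qed
    \<comment> \<open>Each half of the budget of \<open>k\<close> colors serves one purpose:
      \<open>2 ^ L\<close> lies between \<open>k / 4\<close> and \<open>k / 2\<close>, and
      \<open>2 * d * L\<close> is at most \<open>k / 2\<close>.\<close>
    define L d where "L = m - 1" and "d = k div (4 * L)"
    have mL: "m = Suc L" and "L \<ge> 3" using \<open>m \<ge> 4\<close> by (simp_all add: L_def)
    have w: "2 * 2 ^ L \<le> k" "k < 4 * 2 ^ L" using m mL by simp_all
    have "4 * d * L \<le> k" unfolding d_def by (metis div_times_less_eq_dividend mult.assoc mult.commute)
    then have "2 ^ L + 2 * d * L \<le> k" using w(1) by linarith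
    then have "chi_lin (clique_tree L d) \<le> k"
      using chi_lin_clique_tree[of L d] \<open>L \<ge> 3\<close> by linarith
    then have "f (chi_lin (clique_tree L d)) \<le> f k" using \<open>mono f\<close> by (simp add: monoD)
    moreover have "real (chi_cen (clique_tree L d)) \<le> f (chi_lin (clique_tree L d))"
      by (intro assms(2) pair_graph_tree_on[OF subset_refl])
    moreover have "real (d * (2 ^ L - 1)) \<le> real (chi_cen (clique_tree L d))"
      using chi_cen_clique_tree[of d L] by (simp only: of_nat_le_iff)
    ultimately have fk: "real d * (2 ^ L - 1) \<le> f k" by (simp add: of_nat_diff)
    \<comment> \<open>This makes \<open>d\<close> positive, so that rounding down in
      \<open>d\<close> loses at most a factor 2.\<close>
    have "4 * L \<le> k"
    proof -
      have "2 * L \<le> 2 ^ L" using \<open>L \<ge> 3\<close>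
        by (induction L rule: nat_induct_at_least) auto
      then show ?thesis using w(1) by linarith
    qed
    then have "d \<ge> 1" using \<open>L \<ge> 3\<close> by (simp add: d_def div_greater_zero_iff Suc_le_eq)
    have "k < 4 * L * (d + 1)"
      unfolding d_def using dividend_less_times_div[of "4 * L" k] \<open>L \<ge> 3\<close> by simp
    also have "\<dots> \<le> 4 * L * (2 * d)" using \<open>d \<ge> 1\<close> by (intro mult_le_mono) auto
    finally have "k \<le> 8 * L * d" by simp
    then have "real k \<le> real (8 * L * d)" by (simp only: of_nat_le_iff)
    then have d: "real k / (8 * real L) \<le> real d"
      using \<open>L \<ge> 3\<close> by (simp add: field_simps)
    have "(2::real) ^ 3 \<le> 2 ^ L" using \<open>L \<ge> 3\<close> by (intro power_increasing) auto
    moreover have "real k \<le> real (4 * 2 ^ L)"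
      by (intro of_nat_mono less_imp_le w(2))
    ultimately have w': "real k / 8 \<le> 2 ^ L - 1" by simp
    have "real L \<le> log 2 (real k)"
    proof -
      have "real (2 ^ L) \<le> real k"
        using w(1) by (intro of_nat_mono) linarith
      then show ?thesis using k by (simp add: le_log_iff powr_realpow)
    qed
    then have "1 / 64 * (real k)\<^sup>2 / log 2 (real k) \<le> 1 / 64 * (real k)\<^sup>2 / real L"
      using \<open>L \<ge> 3\<close> by (intro divide_left_mono mult_pos_pos) auto
    also have "\<dots> = real k / (8 * real L) * (real k / 8)"
      by (simp add: power2_eq_square)
    also have "\<dots> \<le> real d * (2 ^ L - 1)"
      using d w' by (intro mult_mono) auto
    finally show ?thesis using fk by linarith
  qed
  then show ?thesis
    by (intro exI[of _ "1 / 64"] conjI exI[of _ 16]) auto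
qed

end
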